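(* For an integer $n\ge 2$, let $c(n)$ denote the number of edge colorings $\phi\colon E(K_n)\to\{\text{red},\text{green},\text{blue}\}$ of the complete graph $K_n$ on $n$ labeled vertices that contain no rainbow triangle (a triangle whose three edges receive three distinct colors). Then for all $n\ge 2$, $$c(n)\le 7(n+1)\,2^{\binom{n}{2}}.$$
   Context: The vertices of $K_n$ are labeled, so distinct functions $\phi$ count as distinct colorings. Not all three colors need to be used. *)

theory Defs
  imports Complex_Main "HOL-Library.FuncSet" "HOL-Library.Ramsey"
begin

datatype color = Red | Green | Blue

definition K_edges :: "nat \<Rightarrow> nat set set" where
  "K_edges n = nsets {..<n} 2"

(* The extensional function space has exactly one element for each
   function on the edge set, so that cardinalities are the intended ones. *)
definition edge_colorings :: "nat \<Rightarrow> (nat set \<Rightarrow> color) set" where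
  "edge_colorings n = K_edges n \<rightarrow>\<^sub>E UNIV"

definition rainbow_triangle :: "nat \<Rightarrow> (nat set \<Rightarrow> color) \<Rightarrow> nat \<Rightarrow> nat \<Rightarrow> nat \<Rightarrow> bool" where
  "rainbow_triangle n \<phi> u v w \<longleftrightarrow>
     u < n \<and> v < n \<and> w < n \<and> u \<noteq> v \<and> v \<noteq> w \<and> u \<noteq> w \<and>
     \<phi> {u, v} \<noteq> \<phi> {v, w} \<and> \<phi> {v, w} \<noteq> \<phi> {u, w} \<and> \<phi> {u, v} \<noteq> \<phi> {u, w}"

definition rainbow_free_colorings :: "nat \<Rightarrow> (nat set \<Rightarrow> color) set" where
  "rainbow_free_colorings n =
     {\<phi> \<in> edge_colorings n. \<not> (\<exists>u v w. rainbow_triangle n \<phi> u v w)}"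

definition num_rainbow_free :: "nat \<Rightarrow> nat" where
  "num_rainbow_free n = card (rainbow_free_colorings n)"

lemma finite_UNIV_color: "finite (UNIV :: color set)"
proof -
  have "x \<in> {Red, Green, Blue}" for x by (cases x) simp_all
  then have "(UNIV :: color set) = {Red, Green, Blue}" by blast
  then show ?thesis by (metis finite.emptyI finite.insertI)
qed

lemma finite_edge_colorings: "finite (edge_colorings n)"
  unfolding edge_colorings_def K_edges_def
  by (intro finite_PiE finite_imp_finite_nsets finite_UNIV_color finite_lessThan)

lemma finite_rainbow_free_colorings: "finite (rainbow_free_colorings n)"
  unfolding rainbow_free_colorings_def using finite_edge_colorings by simp

end

theory Submission
  imports Defs
begin

text \<open>
  In a coloring without rainbow triangles (a Gallai coloring) on at least two vertices, some color
  class \<open>c\<close> is disconnected as a spanning graph, and then the edges from a vertex outside a component of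
  color \<open>c\<close> to that component all have the same color. Let \<open>d(n)\<close> bound the number of Gallai colorings of
  an \<open>n\<close>-set whose color \<open>c\<close> is disconnected, and \<open>g(n)\<close> the number of those where it is connected, so
  that one may take \<open>g(n) = 2 d(n)\<close>. Splitting off the component \<open>C\<close> of a fixed vertex, the coloring is
  determined by its restrictions to \<open>C\<close> and to the complement \<open>W\<close>, and by the colors joining each
  vertex of \<open>W\<close> to \<open>C\<close>. These joining colors form a function from \<open>W\<close> to the two other colors that is
  constant along edges of color \<open>c\<close>; with \<open>m = |W|\<close> there are at most \<open>2\<close> of them if \<open>c\<close> connects \<open>W\<close>,
  at most \<open>2^(m-1)\<close> if \<open>c\<close> occurs in \<open>W\<close>, and \<open>2^m\<close> for the at most \<open>2^(m choose 2)\<close> colorings of \<open>W\<close>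
  without \<open>c\<close>. The resulting recurrence for \<open>d\<close> is evaluated exactly for \<open>n < 12\<close>, starting from the
  sharp values \<open>g(1) = g(2) = 1\<close> and \<open>g(3) = 7\<close>; from there on it preserves \<open>d(n) \<le> 12 * 2^(n choose 2)\<close>.
\<close>

subsection \<open>A disconnected color\<close>

text \<open>Formulated over an arbitrary vertex set, because the induction passes to components and
  their complements.\<close>

definition gallai_on :: "'a set \<Rightarrow> ('a set \<Rightarrow> color) \<Rightarrow> bool" where
  "gallai_on V \<phi> \<longleftrightarrow> (\<forall>u\<in>V. \<forall>v\<in>V. \<forall>w\<in>V. u \<noteq> v \<longrightarrow> v \<noteq> w \<longrightarrow> u \<noteq> w \<longrightarrow>
     \<phi> {u, v} = \<phi> {v, w} \<or> \<phi> {v, w} = \<phi> {u, w} \<or> \<phi> {u, v} = \<phi> {u, w})"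

text \<open>A relation on ordered pairs, so that the component of \<open>v\<close> is the image of
  \<open>{v}\<close> under its reflexive transitive closure.\<close>

definition color_adj :: "'a set \<Rightarrow> ('a set \<Rightarrow> color) \<Rightarrow> color \<Rightarrow> ('a \<times> 'a) set" where
  "color_adj V \<phi> c = {(u, v). u \<in> V \<and> v \<in> V \<and> u \<noteq> v \<and> \<phi> {u, v} = c}"

definition color_connected :: "'a set \<Rightarrow> ('a set \<Rightarrow> color) \<Rightarrow> color \<Rightarrow> bool" where
  "color_connected V \<phi> c \<longleftrightarrow> (\<forall>u\<in>V. \<forall>v\<in>V. (u, v) \<in> (color_adj V \<phi> c)\<^sup>*)"

lemma gallai_onD:
  assumes "gallai_on V \<phi>" "u \<in> V" "v \<in> V" "w \<in> V" "u \<noteq> v" "v \<noteq> w" "u \<noteq> w"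
  shows "\<phi> {u, v} = \<phi> {v, w} \<or> \<phi> {v, w} = \<phi> {u, w} \<or> \<phi> {u, v} = \<phi> {u, w}"
  using assms unfolding gallai_on_def by blast

lemma gallai_on_subset: "gallai_on V \<phi> \<Longrightarrow> W \<subseteq> V \<Longrightarrow> gallai_on W \<phi>"
  unfolding gallai_on_def by blast

lemma color_adjI: "\<lbrakk>u \<in> V; v \<in> V; u \<noteq> v; \<phi> {u, v} = c\<rbrakk> \<Longrightarrow> (u, v) \<in> color_adj V \<phi> c"
  by (simp add: color_adj_def)

lemma color_adj_cong:
  assumes "\<And>u v. u \<in> V \<Longrightarrow> v \<in> V \<Longrightarrow> u \<noteq> v \<Longrightarrow> \<phi> {u, v} = \<psi> {u, v}"
  shows "color_adj V \<phi> c = color_adj V \<psi> c"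
  using assms by (auto simp: color_adj_def)

lemma color_adj_rtrancl_sym:
  "(u, v) \<in> (color_adj V \<phi> c)\<^sup>* \<Longrightarrow> (v, u) \<in> (color_adj V \<phi> c)\<^sup>*"
proof -
  have "sym (color_adj V \<phi> c)"
    by (auto simp: sym_def color_adj_def insert_commute)
  then show "(u, v) \<in> (color_adj V \<phi> c)\<^sup>* \<Longrightarrow> (v, u) \<in> (color_adj V \<phi> c)\<^sup>*"
    by (meson sym_rtrancl symD)
qed

lemma color_adj_rtrancl_closed:
  "(u, v) \<in> (color_adj V \<phi> c)\<^sup>* \<Longrightarrow> u \<in> V \<Longrightarrow> v \<in> V"
  by (induction rule: rtrancl_induct) (auto simp: color_adj_def)

text \<open>Along a \<open>c\<close>-path from \<open>u\<close>, consecutive vertices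
  \<open>y\<close>, \<open>z\<close> form with \<open>w\<close> a triangle in which only
  \<open>{y, z}\<close> has color \<open>c\<close>, since \<open>w\<close> lies outside the
  component. As it is not rainbow, its other two edges agree.\<close>

lemma color_constant_to_component:
  assumes "gallai_on V \<phi>" "(u, u') \<in> (color_adj V \<phi> c)\<^sup>*" "u \<in> V" "w \<in> V"
    and "(u, w) \<notin> (color_adj V \<phi> c)\<^sup>*"
  shows "\<phi> {u, w} = \<phi> {u', w}"
  using assms(2)
proof (induction rule: rtrancl_induct)
  case base
  show ?case by simp
next
  case (step y z)
  have yz: "y \<in> V" "z \<in> V" "y \<noteq> z" "\<phi> {y, z} = c"
    using step.hyps(2) by (auto simp: color_adj_def)
  have uz: "(u, z) \<in> (color_adj V \<phi> c)\<^sup>*" using step.hyps by simp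
  have ne: "y \<noteq> w" "z \<noteq> w" using step.hyps(1) uz assms(5) by auto
  have "\<phi> {y, w} \<noteq> c" "\<phi> {z, w} \<noteq> c"
    using color_adjI[of y V w \<phi> c] color_adjI[of z V w \<phi> c] yz ne assms(4,5) step.hyps(1) uz
    by (meson rtrancl.rtrancl_into_rtrancl)+
  then have "\<phi> {y, w} = \<phi> {z, w}"
    using gallai_onD[OF assms(1) yz(1,2) assms(4) yz(3) ne(2,1)] yz(4) by auto
  with step.IH show ?case by simp
qed

lemma exists_two_other_colors: "\<exists>r g. r \<noteq> c \<and> g \<noteq> c \<and> r \<noteq> (g::color) \<and> UNIV = {c, r, g}"
proof -
  have *: "UNIV = {Red, Green, Blue}" by (auto intro: color.exhaust)
  show ?thesis
  proof (cases c)
    case Red then show ?thesis using * by (intro exI[of _ Green] exI[of _ Blue]) auto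
  next
    case Green then show ?thesis using * by (intro exI[of _ Red] exI[of _ Blue]) auto
  next
    case Blue then show ?thesis using * by (intro exI[of _ Green] exI[of _ Red]) auto
  qed
qed

lemma card_other_colors: "card (UNIV - {c::color}) = 2"
proof -
  obtain r g where "r \<noteq> c" "g \<noteq> c" "r \<noteq> g" "UNIV = {c, r, g}"
    using exists_two_other_colors by blast
  then have "UNIV - {c} = {r, g}" by auto
  with \<open>r \<noteq> g\<close> show ?thesis by simp
qed

lemma color_connected_imp_color_at:
  assumes "color_connected V \<phi> c" "v \<in> V" "w \<in> V" "v \<noteq> w"
  shows "\<exists>x\<in>V - {v}. \<phi> {v, x} = c"
proof -
  have "(v, w) \<in> (color_adj V \<phi> c)\<^sup>*"
    using assms unfolding color_connected_def by blast
  with \<open>v \<noteq> w\<close> obtain x where "(v, x) \<in> color_adj V \<phi> c"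
    by (meson converse_rtranclE)
  then show ?thesis by (auto simp: color_adj_def)
qed

text \<open>Induction on the vertices. Let \<open>c\<close> be disconnected on \<open>V\<close>, and
  suppose that adding \<open>v\<close> makes every color connected. Then \<open>v\<close> sends a
  \<open>c\<close>-edge to every \<open>c\<close>-component of \<open>V\<close> and also has edges
  of both other colors. Each of the latter dictates the color of all edges from its endpoint to the
  other components, and the two dictates contradict each other.\<close>

lemma gallai_disconnected_color:
  assumes "finite V" "card V \<ge> 2" "gallai_on V \<phi>"
  shows "\<exists>c. \<not> color_connected V \<phi> c"
  using assms
proof (induction V rule: finite_induct)
  case empty
  then show ?case by simp
next
  case (insert v V)
  show ?case
  proof (cases "card V \<ge> 2")
    case False
    with insert.prems(1) insert.hyps have "card V = 1" by simp
    then obtain x where V: "V = {x}" by (auto simp: card_1_singleton_iff)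
    have vx: "v \<noteq> x" using insert.hyps V by auto
    \<comment> \<open>With a single edge, any color other than that of the edge leaves
      \<open>v\<close> isolated.\<close>
    obtain r where "r \<noteq> \<phi> {v, x}" using exists_two_other_colors by blast
    then have "\<not> color_connected (insert v V) \<phi> r"
      using color_connected_imp_color_at[of "insert v V" \<phi> r v x] V vx by auto
    then show ?thesis by blast
  next
    case True
    have gV: "gallai_on V \<phi>" using insert.prems(2) gallai_on_subset by blast
    obtain c where c: "\<not> color_connected V \<phi> c"
      using insert.IH[OF True gV] by blast
    define E where "E = (color_adj V \<phi> c)\<^sup>*"
    have Esym: "(b, a) \<in> E" if "(a, b) \<in> E" for a b
      using that color_adj_rtrancl_sym unfolding E_def by metis
    have Etrans: "(a, d) \<in> E" if "(a, b) \<in> E" "(b, d) \<in> E" for a b d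
      using that unfolding E_def by (rule rtrancl_trans)
    obtain p q where pq: "p \<in> V" "q \<in> V" "(p, q) \<notin> E"
      using c unfolding color_connected_def E_def by blast
    show ?thesis
    proof (rule ccontr)
      assume "\<nexists>c. \<not> color_connected (insert v V) \<phi> c"
      then have conn: "\<And>d. color_connected (insert v V) \<phi> d" by blast
      \<comment> \<open>A \<open>c\<close>-path from \<open>u\<close> to \<open>v\<close> stays in
        the component of \<open>u\<close> within \<open>V\<close> until it first reaches
        \<open>v\<close>; the vertex just before is the required \<open>y\<close>. The induction
        keeps the alternative "still in the component, or such a \<open>y\<close> exists".\<close>
      have joined: "\<exists>y\<in>V. (u, y) \<in> E \<and> \<phi> {v, y} = c" if u: "u \<in> V" for u
      proof -
        have "(u, z) \<in> (color_adj (insert v V) \<phi> c)\<^sup>* \<Longrightarrow>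
          (z \<in> V \<and> (u, z) \<in> E) \<or> (\<exists>y\<in>V. (u, y) \<in> E \<and> \<phi> {v, y} = c)" for z
        proof (induction rule: rtrancl_induct)
          case base
          then show ?case using u by (simp add: E_def)
        next
          case (step y z)
          from step.IH show ?case
          proof
            assume y: "y \<in> V \<and> (u, y) \<in> E"
            have yz: "z \<in> insert v V" "y \<noteq> z" "\<phi> {y, z} = c"
              using step.hyps(2) by (auto simp: color_adj_def)
            show ?thesis
            proof (cases "z = v")
              case True
              then show ?thesis using y yz by (metis insert_commute)
            next
              case False
              then have "(y, z) \<in> color_adj V \<phi> c" using y yz by (simp add: color_adj_def)
              then have "(u, z) \<in> E" using y unfolding E_def by (meson rtrancl.rtrancl_into_rtrancl)
              then show ?thesis using False yz(1) by simp
            qed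
          qed simp
        qed
        moreover have "(u, v) \<in> (color_adj (insert v V) \<phi> c)\<^sup>*"
          using conn u unfolding color_connected_def by blast
        ultimately show ?thesis using insert.hyps(2) by blast
      qed
      have edge: "\<exists>x\<in>V. \<phi> {v, x} = d" for d
        using color_connected_imp_color_at[OF conn, of v p d] pq(1) insert.hyps(2) by auto
      \<comment> \<open>Let \<open>y\<close> be a \<open>c\<close>-neighbor of \<open>v\<close> in
        the component of \<open>w\<close>. In the triangle \<open>v\<close>, \<open>x\<close>,
        \<open>y\<close> only \<open>{v, y}\<close> has color \<open>c\<close>, so
        \<open>{x, y}\<close> has the color of \<open>{v, x}\<close>; constancy on the component of
        \<open>w\<close> carries this over to \<open>{x, w}\<close>.\<close>
      have out: "\<phi> {x, w} = \<phi> {v, x}"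
        if x: "x \<in> V" "\<phi> {v, x} \<noteq> c" and w: "w \<in> V" "(x, w) \<notin> E" for x w
      proof -
        obtain y where y: "y \<in> V" "(w, y) \<in> E" "\<phi> {v, y} = c" using joined[OF w(1)] by blast
        have xy: "(x, y) \<notin> E" using y(2) w(2) Esym[of w y] Etrans[of x y w] by blast
        then have "x \<noteq> y" by (auto simp: E_def)
        have "\<phi> {x, y} \<noteq> c" using color_adjI[OF x(1) y(1) \<open>x \<noteq> y\<close>] xy unfolding E_def by auto
        moreover have "v \<noteq> x" "v \<noteq> y" using insert.hyps(2) x(1) y(1) by auto
        ultimately have "\<phi> {x, y} = \<phi> {v, x}"
          using gallai_onD[OF insert.prems(2), of v x y] x y \<open>x \<noteq> y\<close> by auto
        moreover have "\<phi> {w, x} = \<phi> {y, x}"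
        proof (rule color_constant_to_component[OF gV _ w(1) x(1)])
          show "(w, y) \<in> (color_adj V \<phi> c)\<^sup>*" using y(2) by (simp add: E_def)
          show "(w, x) \<notin> (color_adj V \<phi> c)\<^sup>*" using w(2) Esym by (auto simp: E_def)
        qed
        ultimately show ?thesis by (simp add: insert_commute)
      qed
      obtain r g where rg: "r \<noteq> c" "g \<noteq> c" "r \<noteq> g" using exists_two_other_colors by blast
      obtain x z where x: "x \<in> V" "\<phi> {v, x} = r" and z: "z \<in> V" "\<phi> {v, z} = g"
        using edge by blast
      show False
      \<comment> \<open>In different components, the edge \<open>{x, z}\<close> would need both
        colors \<open>r\<close> and \<open>g\<close>. In the same component, a vertex
        \<open>w\<close> outside it sees \<open>x\<close> in color \<open>r\<close> and
        \<open>z\<close> in color \<open>g\<close>, against constancy.\<close>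
      proof (cases "(x, z) \<in> E")
        case False
        then have "(z, x) \<notin> E" using Esym by blast
        then show False using False out[of x z] out[of z x] x z rg by (auto simp: insert_commute)
      next
        case True
        obtain w where w: "w \<in> V" "(x, w) \<notin> E"
          using pq Esym[of x p] Etrans[of p x q] by blast
        have "(z, w) \<notin> E" using w(2) True Etrans[of x z w] by blast
        then have "\<phi> {x, w} = r" "\<phi> {z, w} = g" using out x z w rg by auto
        moreover have "\<phi> {x, w} = \<phi> {z, w}"
          using color_constant_to_component[OF gV _ x(1) w(1)] True w(2) unfolding E_def by blast
        ultimately show False using rg by simp
      qed
    qed
  qed
qed

subsection \<open>Splitting off a component\<close>

definition gallai_colorings :: "'a set \<Rightarrow> ('a set \<Rightarrow> color) set" where
  "gallai_colorings V = {\<phi> \<in> nsets V 2 \<rightarrow>\<^sub>E UNIV. gallai_on V \<phi>}"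

definition connected_colorings :: "'a set \<Rightarrow> color \<Rightarrow> ('a set \<Rightarrow> color) set" where
  "connected_colorings V c = {\<phi> \<in> gallai_colorings V. color_connected V \<phi> c}"

definition disconnected_colorings :: "'a set \<Rightarrow> color \<Rightarrow> ('a set \<Rightarrow> color) set" where
  "disconnected_colorings V c = {\<phi> \<in> gallai_colorings V. \<not> color_connected V \<phi> c}"

text \<open>The possible colors of the edges from the vertices of \<open>W\<close> to a \<open>c\<close>-component disjoint from \<open>W\<close>.\<close>

definition attachments :: "'a set \<Rightarrow> color \<Rightarrow> ('a set \<Rightarrow> color) \<Rightarrow> ('a \<Rightarrow> color) set" where
  "attachments W c \<psi> =
     {h \<in> W \<rightarrow>\<^sub>E (UNIV - {c}). \<forall>x\<in>W. \<forall>y\<in>W. x \<noteq> y \<longrightarrow> \<psi> {x, y} = c \<longrightarrow> h x = h y}"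

lemma finite_gallai_colorings: "finite V \<Longrightarrow> finite (gallai_colorings V)"
  unfolding gallai_colorings_def
  by (simp add: finite_PiE finite_imp_finite_nsets finite_UNIV_color)

lemma finite_connected_colorings: "finite V \<Longrightarrow> finite (connected_colorings V c)"
  by (simp add: connected_colorings_def finite_gallai_colorings)

lemma finite_disconnected_colorings: "finite V \<Longrightarrow> finite (disconnected_colorings V c)"
  by (simp add: disconnected_colorings_def finite_gallai_colorings)

lemma finite_other_colors: "finite (UNIV - {c::color})"
  using finite_UNIV_color by simp

lemma finite_attachments: "finite W \<Longrightarrow> finite (attachments W c \<psi>)"
  unfolding attachments_def by (simp add: finite_PiE finite_UNIV_color)

lemma gallai_on_cong:
  assumes "\<And>u v. u \<in> V \<Longrightarrow> v \<in> V \<Longrightarrow> u \<noteq> v \<Longrightarrow> \<phi> {u, v} = \<psi> {u, v}"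
  shows "gallai_on V \<phi> = gallai_on V \<psi>"
  unfolding gallai_on_def using assms by simp

lemma restrict_in_gallai_colorings:
  assumes "\<phi> \<in> gallai_colorings V" "W \<subseteq> V"
  shows "restrict \<phi> (nsets W 2) \<in> gallai_colorings W"
proof -
  have "gallai_on W \<phi>"
    using assms gallai_on_subset unfolding gallai_colorings_def by blast
  moreover have "gallai_on W (restrict \<phi> (nsets W 2)) = gallai_on W \<phi>"
    by (rule gallai_on_cong) simp
  ultimately show ?thesis unfolding gallai_colorings_def by simp
qed

lemma gallai_colorings_eqI:
  assumes "\<phi> \<in> gallai_colorings V" "\<psi> \<in> gallai_colorings V"
    and "\<And>u v. u \<in> V \<Longrightarrow> v \<in> V \<Longrightarrow> u \<noteq> v \<Longrightarrow> \<phi> {u, v} = \<psi> {u, v}"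
  shows "\<phi> = \<psi>"
proof (rule PiE_ext)
  show "\<phi> \<in> nsets V 2 \<rightarrow>\<^sub>E UNIV" "\<psi> \<in> nsets V 2 \<rightarrow>\<^sub>E UNIV"
    using assms(1,2) by (auto simp: gallai_colorings_def)
  show "\<phi> e = \<psi> e" if "e \<in> nsets V 2" for e
    using that assms(3) by (auto elim!: nsets2_E)
qed

text \<open>Some color is disconnected in every Gallai coloring. If \<open>c\<close> is connected,
  it is one of the two others, whence the factor 2.\<close>

lemma card_connected_le_disconnected:
  fixes V :: "'a set"
  assumes "finite V" "card V \<ge> 2" "\<And>c. card (disconnected_colorings V c) \<le> d"
  shows "card (connected_colorings V c) \<le> 2 * d"
proof -
  have fin: "finite (\<Union>c'\<in>UNIV - {c}. disconnected_colorings V c')"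
    using finite_other_colors finite_disconnected_colorings[OF assms(1)] by auto
  have "connected_colorings V c \<subseteq> (\<Union>c'\<in>UNIV - {c}. disconnected_colorings V c')"
    using gallai_disconnected_color[OF assms(1,2)]
    by (force simp: connected_colorings_def disconnected_colorings_def gallai_colorings_def)
  then have "card (connected_colorings V c) \<le> card (\<Union>c'\<in>UNIV - {c}. disconnected_colorings V c')"
    using fin card_mono by blast
  also have "\<dots> \<le> (\<Sum>c'\<in>UNIV - {c}. card (disconnected_colorings V c'))"
    by (rule card_UN_le[OF finite_other_colors])
  also have "\<dots> \<le> (\<Sum>c'\<in>UNIV - {c}. d)" by (intro sum_mono assms(3))
  finally show ?thesis by (simp add: card_other_colors)
qed

lemma card_gallai_colorings_eq:
  assumes "finite V"
  shows "card (gallai_colorings V) = card (connected_colorings V c) + card (disconnected_colorings V c)"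
proof -
  have "gallai_colorings V = connected_colorings V c \<union> disconnected_colorings V c"
    by (auto simp: connected_colorings_def disconnected_colorings_def)
  moreover have "connected_colorings V c \<inter> disconnected_colorings V c = {}"
    by (auto simp: connected_colorings_def disconnected_colorings_def)
  ultimately show ?thesis
    using card_Un_disjoint finite_connected_colorings finite_disconnected_colorings assms by metis
qed

section \<open>Counting attachments\<close>

lemma card_attachments_le:
  assumes "finite W"
  shows "card (attachments W c \<psi>) \<le> 2 ^ card W"
proof -
  have "card (attachments W c \<psi>) \<le> card (W \<rightarrow>\<^sub>E (UNIV - {c}))"
    by (rule card_mono) (auto simp: attachments_def assms finite_PiE finite_UNIV_color)
  also have "\<dots> = 2 ^ card W" using assms by (simp add: card_PiE card_other_colors)
  finally show ?thesis .
qed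

text \<open>The value at \<open>y\<close> equals the value at \<open>x\<close>, so restricting to
  \<open>W - {y}\<close> loses nothing.\<close>

lemma card_attachments_edge:
  assumes "finite W" "x \<in> W" "y \<in> W" "x \<noteq> y" "\<psi> {x, y} = c"
  shows "card (attachments W c \<psi>) \<le> 2 ^ (card W - 1)"
proof -
  have "inj_on (\<lambda>h. restrict h (W - {y})) (attachments W c \<psi>)"
  proof (rule inj_onI)
    fix h k assume h: "h \<in> attachments W c \<psi>" and k: "k \<in> attachments W c \<psi>"
      and eq: "restrict h (W - {y}) = restrict k (W - {y})"
    have eq': "h w = k w" if "w \<in> W - {y}" for w
      using eq that by (metis restrict_apply')
    have "h y = h x" "k y = k x" using h k assms unfolding attachments_def by (auto dest: sym)
    then have "h y = k y" using eq'[of x] assms by simp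
    show "h = k"
    proof (rule PiE_ext)
      show "h \<in> W \<rightarrow>\<^sub>E (UNIV - {c})" "k \<in> W \<rightarrow>\<^sub>E (UNIV - {c})"
        using h k by (auto simp: attachments_def)
      show "h w = k w" if "w \<in> W" for w
        using that eq' \<open>h y = k y\<close> by (cases "w = y") auto
    qed
  qed
  moreover have "(\<lambda>h. restrict h (W - {y})) ` attachments W c \<psi> \<subseteq> (W - {y}) \<rightarrow>\<^sub>E (UNIV - {c})"
    by (auto simp: attachments_def)
  ultimately have "card (attachments W c \<psi>) \<le> card ((W - {y}) \<rightarrow>\<^sub>E (UNIV - {c}))"
    by (rule card_inj_on_le) (simp add: assms finite_PiE finite_UNIV_color)
  also have "\<dots> = 2 ^ (card W - 1)" using assms by (simp add: card_PiE card_other_colors)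
  finally show ?thesis .
qed

text \<open>An attachment is constant along \<open>c\<close>-paths, hence determined by its value at
  one vertex.\<close>

lemma card_attachments_connected:
  assumes "finite W" "W \<noteq> {}" "color_connected W \<psi> c"
  shows "card (attachments W c \<psi>) \<le> 2"
proof -
  obtain a where a: "a \<in> W" using assms(2) by blast
  have const: "h w = h a" if h: "h \<in> attachments W c \<psi>" and w: "w \<in> W" for h w
  proof -
    have "(a, w) \<in> (color_adj W \<psi> c)\<^sup>*" using assms(3) a w by (auto simp: color_connected_def)
    then show ?thesis
    proof (induction rule: rtrancl_induct)
      case (step y z)
      then have "h y = h z" using h by (auto simp: attachments_def color_adj_def)
      then show ?case using step.IH by simp
    qed simp
  qed
  have "inj_on (\<lambda>h. h a) (attachments W c \<psi>)"
  proof (rule inj_onI)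
    fix h k assume h: "h \<in> attachments W c \<psi>" and k: "k \<in> attachments W c \<psi>" and "h a = k a"
    show "h = k"
    proof (rule PiE_ext)
      show "h \<in> W \<rightarrow>\<^sub>E (UNIV - {c})" "k \<in> W \<rightarrow>\<^sub>E (UNIV - {c})"
        using h k by (auto simp: attachments_def)
      show "h w = k w" if "w \<in> W" for w
        using const[OF h that] const[OF k that] \<open>h a = k a\<close> by simp
    qed
  qed
  moreover have "(\<lambda>h. h a) ` attachments W c \<psi> \<subseteq> UNIV - {c}"
    using a by (auto simp: attachments_def PiE_iff)
  ultimately have "card (attachments W c \<psi>) \<le> card (UNIV - {c})"
    by (rule card_inj_on_le) (rule finite_other_colors)
  then show ?thesis by (simp add: card_other_colors)
qed

text \<open>Two colors remain for each edge; the Gallai condition is dropped for the count.\<close>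

lemma card_avoiding_color:
  assumes "finite W"
  shows "card {\<psi> \<in> gallai_colorings W. \<forall>x\<in>W. \<forall>y\<in>W. x \<noteq> y \<longrightarrow> \<psi> {x, y} \<noteq> c}
    \<le> 2 ^ (card W choose 2)"
proof -
  have "{\<psi> \<in> gallai_colorings W. \<forall>x\<in>W. \<forall>y\<in>W. x \<noteq> y \<longrightarrow> \<psi> {x, y} \<noteq> c}
      \<subseteq> nsets W 2 \<rightarrow>\<^sub>E (UNIV - {c})"
    by (auto simp: gallai_colorings_def PiE_iff extensional_def elim!: nsets2_E)
  then have "card {\<psi> \<in> gallai_colorings W. \<forall>x\<in>W. \<forall>y\<in>W. x \<noteq> y \<longrightarrow> \<psi> {x, y} \<noteq> c}
      \<le> card (nsets W 2 \<rightarrow>\<^sub>E (UNIV - {c}))"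
    by (rule card_mono[rotated])
      (simp add: assms finite_PiE finite_UNIV_color finite_imp_finite_nsets)
  also have "\<dots> = 2 ^ (card W choose 2)"
    by (simp add: card_PiE card_other_colors assms finite_imp_finite_nsets)
  finally show ?thesis .
qed

lemma sum_attachments_split:
  assumes "finite W"
  shows "(\<Sum>\<psi>\<in>gallai_colorings W. card (attachments W c \<psi>)) =
    (\<Sum>\<psi>\<in>connected_colorings W c. card (attachments W c \<psi>)) +
    (\<Sum>\<psi>\<in>disconnected_colorings W c. card (attachments W c \<psi>))"
proof -
  have "gallai_colorings W = connected_colorings W c \<union> disconnected_colorings W c"
    by (auto simp: connected_colorings_def disconnected_colorings_def)
  moreover have "connected_colorings W c \<inter> disconnected_colorings W c = {}"
    by (auto simp: connected_colorings_def disconnected_colorings_def)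
  ultimately show ?thesis
    using sum.union_disjoint finite_connected_colorings finite_disconnected_colorings assms by metis
qed

lemma sum_attachments_connected:
  assumes "finite W" "W \<noteq> {}"
  shows "(\<Sum>\<psi>\<in>connected_colorings W c. card (attachments W c \<psi>)) \<le> 2 * card (connected_colorings W c)"
proof -
  have "(\<Sum>\<psi>\<in>connected_colorings W c. card (attachments W c \<psi>)) \<le> (\<Sum>\<psi>\<in>connected_colorings W c. 2)"
    by (rule sum_mono) (simp add: connected_colorings_def card_attachments_connected[OF assms])
  then show ?thesis by simp
qed

lemma sum_attachments_disconnected:
  fixes W :: "'a set"
  assumes "finite W" "W \<noteq> {}"
  shows "(\<Sum>\<psi>\<in>disconnected_colorings W c. card (attachments W c \<psi>))
    \<le> 2 ^ (card W - 1) * (card (disconnected_colorings W c) + 2 ^ (card W choose 2))"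
proof -
  let ?m = "2 ^ (card W - 1) :: nat"
  define A where "A = {\<psi> \<in> gallai_colorings W. \<forall>x\<in>W. \<forall>y\<in>W. x \<noteq> y \<longrightarrow> \<psi> {x, y} \<noteq> c}"
  have finA: "finite A" using finite_gallai_colorings[OF assms(1)] by (simp add: A_def)
  have finD: "finite (disconnected_colorings W c)" by (rule finite_disconnected_colorings[OF assms(1)])
  have W: "(2::nat) ^ card W = ?m + ?m"
    using assms by (metis card_gt_0_iff mult_2 power_minus_mult mult.commute)
  have "(\<Sum>\<psi>\<in>disconnected_colorings W c. card (attachments W c \<psi>))
      \<le> (\<Sum>\<psi>\<in>disconnected_colorings W c. ?m + (if \<psi> \<in> A then ?m else 0))"
  proof (rule sum_mono)
    fix \<psi> assume \<psi>: "\<psi> \<in> disconnected_colorings W c"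
    show "card (attachments W c \<psi>) \<le> ?m + (if \<psi> \<in> A then ?m else 0)"
    proof (cases "\<psi> \<in> A")
      case True
      then show ?thesis using card_attachments_le[OF assms(1), of c \<psi>] W by simp
    next
      case False
      then obtain x y where "x \<in> W" "y \<in> W" "x \<noteq> y" "\<psi> {x, y} = c"
        using \<psi> by (auto simp: A_def disconnected_colorings_def)
      then show ?thesis using card_attachments_edge[OF assms(1)] False by simp
    qed
  qed
  also have "\<dots> = card (disconnected_colorings W c) * ?m + card (disconnected_colorings W c \<inter> A) * ?m"
    by (simp add: sum.distrib sum.inter_restrict[OF finD, symmetric])
  also have "\<dots> \<le> card (disconnected_colorings W c) * ?m + 2 ^ (card W choose 2) * ?m"
  proof -
    have "card (disconnected_colorings W c \<inter> A) \<le> card A" by (simp add: card_mono finA)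
    also have "\<dots> \<le> 2 ^ (card W choose 2)" unfolding A_def by (rule card_avoiding_color[OF assms(1)])
    finally show ?thesis by simp
  qed
  finally show ?thesis by (simp add: algebra_simps)
qed

section \<open>Decomposition along the component of a fixed vertex\<close>

lemma component_color_connected:
  fixes V :: "'a set"
  assumes "v \<in> V" and C: "C = (color_adj V \<phi> c)\<^sup>* `` {v}"
  shows "color_connected C \<phi> c"
proof -
  have CV: "C \<subseteq> V" using assms color_adj_rtrancl_closed by fastforce
  have reach: "(v, w) \<in> (color_adj C \<phi> c)\<^sup>*" if "(v, w) \<in> (color_adj V \<phi> c)\<^sup>*" for w
    using that
  proof (induction rule: rtrancl_induct)
    case (step y z)
    \<comment> \<open>Both ends of the step are reachable from \<open>v\<close>, so the edge lies
      inside \<open>C\<close>.\<close>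
    have "(v, z) \<in> (color_adj V \<phi> c)\<^sup>*" using step.hyps by (meson rtrancl.rtrancl_into_rtrancl)
    then have "(y, z) \<in> color_adj C \<phi> c"
      using step.hyps C by (auto simp: color_adj_def)
    then show ?case using step.IH by (meson rtrancl.rtrancl_into_rtrancl)
  qed simp
  show ?thesis unfolding color_connected_def
  proof (intro ballI)
    fix a b assume "a \<in> C" "b \<in> C"
    then have "(v, a) \<in> (color_adj C \<phi> c)\<^sup>*" "(v, b) \<in> (color_adj C \<phi> c)\<^sup>*"
      using reach C by auto
    then show "(a, b) \<in> (color_adj C \<phi> c)\<^sup>*"
      using color_adj_rtrancl_sym rtrancl_trans by metis
  qed
qed

text \<open>A coloring is encoded by its restrictions to \<open>C\<close> and to
  \<open>V - C\<close> and by the colors of the edges from \<open>v\<close> to \<open>V - C\<close>.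
  The encoding is injective because every edge from \<open>C\<close> to \<open>w\<close> outside has
  the color of \<open>{v, w}\<close>.\<close>

lemma card_component_fixed:
  fixes V :: "'a set"
  assumes fin: "finite V" and vC: "v \<in> C" "C \<subseteq> V"
  shows "card {\<phi> \<in> gallai_colorings V. (color_adj V \<phi> c)\<^sup>* `` {v} = C}
    \<le> card (connected_colorings C c) *
       (\<Sum>\<psi>\<in>gallai_colorings (V - C). card (attachments (V - C) c \<psi>))"
    (is "card ?L \<le> _")
proof -
  let ?W = "V - C"
  define F where "F \<phi> = (restrict \<phi> (nsets C 2), restrict \<phi> (nsets ?W 2), restrict (\<lambda>w. \<phi> {v, w}) ?W)" for \<phi> :: "'a set \<Rightarrow> color"
  let ?R = "connected_colorings C c \<times> Sigma (gallai_colorings ?W) (attachments ?W c)"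
  have vV: "v \<in> V" using vC by blast
  have finC: "finite C" using fin vC finite_subset by blast
  have cross: "\<phi> {x, w} = \<phi> {v, w} \<and> \<phi> {x, w} \<noteq> c"
    if \<phi>: "\<phi> \<in> ?L" and x: "x \<in> C" and w: "w \<in> ?W" for \<phi> x w
  proof
    have g: "gallai_on V \<phi>" using \<phi> by (simp add: gallai_colorings_def)
    have vx: "(v, x) \<in> (color_adj V \<phi> c)\<^sup>*" and vw: "(v, w) \<notin> (color_adj V \<phi> c)\<^sup>*"
      using \<phi> x w by auto
    show "\<phi> {x, w} = \<phi> {v, w}"
      using color_constant_to_component[OF g vx vV _ vw] w by simp
    have "(x, w) \<notin> color_adj V \<phi> c" using vx vw by (meson rtrancl.rtrancl_into_rtrancl)
    then show "\<phi> {x, w} \<noteq> c" using x w vC by (auto simp: color_adj_def)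
  qed
  have "inj_on F ?L"
  proof (rule inj_onI)
    fix \<phi> \<psi> assume \<phi>: "\<phi> \<in> ?L" and \<psi>: "\<psi> \<in> ?L" and eq: "F \<phi> = F \<psi>"
    have eqC: "\<phi> {x, y} = \<psi> {x, y}" if "x \<in> C" "y \<in> C" "x \<noteq> y" for x y
    proof -
      have "restrict \<phi> (nsets C 2) {x, y} = restrict \<psi> (nsets C 2) {x, y}" using eq by (simp add: F_def)
      then show ?thesis using that by simp
    qed
    have eqW: "\<phi> {x, y} = \<psi> {x, y}" if "x \<in> ?W" "y \<in> ?W" "x \<noteq> y" for x y
    proof -
      have "restrict \<phi> (nsets ?W 2) {x, y} = restrict \<psi> (nsets ?W 2) {x, y}" using eq by (simp add: F_def)
      then show ?thesis using that by simp
    qed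
    have eqX: "\<phi> {x, w} = \<psi> {x, w}" if "x \<in> C" "w \<in> ?W" for x w
    proof -
      have "restrict (\<lambda>w. \<phi> {v, w}) ?W w = restrict (\<lambda>w. \<psi> {v, w}) ?W w" using eq by (simp add: F_def)
      then show ?thesis using that cross[OF \<phi> that] cross[OF \<psi> that] by simp
    qed
    show "\<phi> = \<psi>"
    proof (rule gallai_colorings_eqI)
      show "\<phi> \<in> gallai_colorings V" "\<psi> \<in> gallai_colorings V" using \<phi> \<psi> by auto
      fix x y assume xy: "x \<in> V" "y \<in> V" "x \<noteq> y"
      show "\<phi> {x, y} = \<psi> {x, y}"
        using eqC[of x y] eqW[of x y] eqX[of x y] eqX[of y x] xy
        by (cases "x \<in> C"; cases "y \<in> C") (simp_all add: insert_commute)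
    qed
  qed
  moreover have "F ` ?L \<subseteq> ?R"
  proof
    fix z assume "z \<in> F ` ?L"
    then obtain \<phi> where \<phi>: "\<phi> \<in> ?L" and z: "z = F \<phi>" by blast
    have g: "\<phi> \<in> gallai_colorings V" "gallai_on V \<phi>" using \<phi> by (auto simp: gallai_colorings_def)
    have "color_connected C \<phi> c"
      by (rule component_color_connected[OF vV]) (use \<phi> in simp)
    moreover have "color_adj C (restrict \<phi> (nsets C 2)) c = color_adj C \<phi> c"
      by (rule color_adj_cong) simp
    ultimately have "restrict \<phi> (nsets C 2) \<in> connected_colorings C c"
      using restrict_in_gallai_colorings[OF g(1) vC(2)]
      by (simp add: connected_colorings_def color_connected_def)
    moreover have "restrict \<phi> (nsets ?W 2) \<in> gallai_colorings ?W"
      by (rule restrict_in_gallai_colorings[OF g(1)]) blast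
    moreover have "restrict (\<lambda>w. \<phi> {v, w}) ?W \<in> attachments ?W c (restrict \<phi> (nsets ?W 2))"
    proof -
      \<comment> \<open>In the triangle \<open>v\<close>, \<open>x\<close>, \<open>y\<close> the
        edges at \<open>v\<close> leave the component and so avoid \<open>c\<close>, while
        \<open>{x, y}\<close> has color \<open>c\<close>; hence the edges at \<open>v\<close>
        agree.\<close>
      have "\<phi> {v, x} = \<phi> {v, y}" if "x \<in> ?W" "y \<in> ?W" "x \<noteq> y" "\<phi> {x, y} = c" for x y
        using gallai_onD[OF g(2) vV, of x y] that cross[OF \<phi> vC(1), of x] cross[OF \<phi> vC(1), of y] vC(1)
        by auto
      then show ?thesis using cross[OF \<phi> vC(1)] by (auto simp: attachments_def)
    qed
    ultimately show "z \<in> ?R" by (simp add: z F_def)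
  qed
  moreover have "finite ?R"
    using finite_connected_colorings[OF finC] finite_gallai_colorings[of ?W] finite_attachments[of ?W] fin
    by (intro finite_cartesian_product finite_SigmaI) auto
  ultimately have "card ?L \<le> card ?R" by (rule card_inj_on_le)
  also have "\<dots> = card (connected_colorings C c) *
       (\<Sum>\<psi>\<in>gallai_colorings ?W. card (attachments ?W c \<psi>))"
    using finite_gallai_colorings[of ?W] finite_attachments[of ?W] fin
    by (simp add: card_cartesian_product)
  finally show ?thesis .
qed

text \<open>The colorings are classified by the \<open>c\<close>-component \<open>C\<close> of
  \<open>v\<close>, which is a proper subset of \<open>V\<close> exactly because \<open>c\<close> is
  disconnected.\<close>

lemma card_disconnected_le_sum:
  fixes V :: "'a set"
  assumes fin: "finite V" and vV: "v \<in> V"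
  shows "card (disconnected_colorings V c) \<le>
    (\<Sum>C\<in>{C. v \<in> C \<and> C \<subset> V}. card (connected_colorings C c) *
       (\<Sum>\<psi>\<in>gallai_colorings (V - C). card (attachments (V - C) c \<psi>)))"
proof -
  let ?I = "{C. v \<in> C \<and> C \<subset> V}"
  let ?L = "\<lambda>C. {\<phi> \<in> gallai_colorings V. (color_adj V \<phi> c)\<^sup>* `` {v} = C}"
  have finI: "finite ?I" by (rule finite_subset[of _ "Pow V"]) (use fin in auto)
  have "disconnected_colorings V c \<subseteq> (\<Union>C\<in>?I. ?L C)"
  proof
    fix \<phi> assume \<phi>: "\<phi> \<in> disconnected_colorings V c"
    let ?C = "(color_adj V \<phi> c)\<^sup>* `` {v}"
    have "?C \<subseteq> V" using color_adj_rtrancl_closed vV by fastforce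
    moreover have "?C \<noteq> V"
    proof
      assume *: "?C = V"
      then have "color_connected V \<phi> c" using component_color_connected[OF vV, of ?C \<phi> c] by simp
      then show False using \<phi> by (simp add: disconnected_colorings_def)
    qed
    ultimately show "\<phi> \<in> (\<Union>C\<in>?I. ?L C)"
      using \<phi> by (auto simp: disconnected_colorings_def)
  qed
  then have "card (disconnected_colorings V c) \<le> card (\<Union>C\<in>?I. ?L C)"
    by (rule card_mono[rotated]) (use finI finite_gallai_colorings[OF fin] in auto)
  also have "\<dots> \<le> (\<Sum>C\<in>?I. card (?L C))" by (rule card_UN_le[OF finI])
  also have "\<dots> \<le> (\<Sum>C\<in>?I. card (connected_colorings C c) *
       (\<Sum>\<psi>\<in>gallai_colorings (V - C). card (attachments (V - C) c \<psi>)))"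
    by (rule sum_mono, rule card_component_fixed[OF fin]) auto
  finally show ?thesis .
qed

text \<open>Removing \<open>v\<close> matches the sets of size \<open>j\<close> containing
  \<open>v\<close> with the subsets of \<open>V - {v}\<close> of size \<open>j - 1\<close>.\<close>

lemma sum_proper_subsets_containing:
  fixes f :: "nat \<Rightarrow> nat"
  assumes "finite V" "v \<in> V"
  shows "(\<Sum>C\<in>{C. v \<in> C \<and> C \<subset> V}. f (card C))
    = (\<Sum>j\<in>{1..<card V}. (card V - 1 choose (j - 1)) * f j)"
proof -
  let ?I = "{C. v \<in> C \<and> C \<subset> V}"
  have finI: "finite ?I" by (rule finite_subset[of _ "Pow V"]) (use assms(1) in auto)
  have img: "card ` ?I \<subseteq> {1..<card V}"
  proof (rule image_subsetI)
    fix C assume "C \<in> ?I"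
    then have "v \<in> C" "C \<subset> V" by auto
    moreover have "finite C" "card C < card V"
      using \<open>C \<subset> V\<close> assms(1) by (auto intro: finite_subset psubset_card_mono)
    ultimately have "v \<in> C" "finite C" "card C < card V" by auto
    then show "card C \<in> {1..<card V}" by (auto simp: Suc_le_eq card_gt_0_iff)
  qed
  have "(\<Sum>C\<in>?I. f (card C)) = (\<Sum>j\<in>{1..<card V}. \<Sum>C\<in>{C \<in> ?I. card C = j}. f (card C))"
    by (rule sum.group[OF finI _ img, symmetric]) simp
  also have "\<dots> = (\<Sum>j\<in>{1..<card V}. (card V - 1 choose (j - 1)) * f j)"
  proof (rule sum.cong[OF refl])
    fix j assume j: "j \<in> {1..<card V}"
    have "bij_betw (insert v) {B. B \<subseteq> V - {v} \<and> card B = j - 1} {C \<in> ?I. card C = j}"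
    proof (rule bij_betw_byWitness[where f' = "\<lambda>C. C - {v}"])
      show "insert v ` {B. B \<subseteq> V - {v} \<and> card B = j - 1} \<subseteq> {C \<in> ?I. card C = j}"
      proof (rule image_subsetI)
        fix B assume "B \<in> {B. B \<subseteq> V - {v} \<and> card B = j - 1}"
        then have B: "B \<subseteq> V - {v}" "card B = j - 1" by auto
        then have "finite B" "v \<notin> B" using assms finite_subset by auto
        then have c: "card (insert v B) = j" using B(2) j by simp
        then have "insert v B \<noteq> V" using j by auto
        then show "insert v B \<in> {C \<in> ?I. card C = j}" using B c assms by auto
      qed
      show "(\<lambda>C. C - {v}) ` {C \<in> ?I. card C = j} \<subseteq> {B. B \<subseteq> V - {v} \<and> card B = j - 1}"
        using assms by (auto simp: card_Diff_singleton)
    qed auto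
    then have "card {C \<in> ?I. card C = j} = card {B. B \<subseteq> V - {v} \<and> card B = j - 1}"
      by (rule bij_betw_same_card[symmetric])
    also have "\<dots> = (card V - 1 choose (j - 1))"
      using n_subsets[of "V - {v}" "j - 1"] assms by simp
    finally show "(\<Sum>C\<in>{C \<in> ?I. card C = j}. f (card C)) = (card V - 1 choose (j - 1)) * f j"
      by simp
  qed
  finally show ?thesis .
qed

section \<open>Sharp counts for at most three vertices\<close>

lemma card_connected_singleton: "card (connected_colorings {a} c) \<le> 1"
proof -
  have "nsets {a} 2 = {}" by (simp add: nsets_singleton_iff)
  then have "connected_colorings {a} c \<subseteq> {\<lambda>_. undefined}"
    by (auto simp: connected_colorings_def gallai_colorings_def)
  from card_mono[OF _ this] show ?thesis by simp
qed

lemma disconnected_singleton: "disconnected_colorings {a} c = {}"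
  by (auto simp: disconnected_colorings_def color_connected_def)

lemma card_connected_two:
  assumes "card V = 2"
  shows "card (connected_colorings V c) \<le> 1"
proof -
  obtain a b where V: "V = {a, b}" "a \<noteq> b" using assms by (auto simp: card_2_iff)
  have ab: "\<phi> {a, b} = c" if "\<phi> \<in> connected_colorings V c" for \<phi>
    using that color_connected_imp_color_at[of V \<phi> c a b] V
    by (auto simp: connected_colorings_def)
  have "\<phi> = \<psi>" if "\<phi> \<in> connected_colorings V c" "\<psi> \<in> connected_colorings V c" for \<phi> \<psi>
    using that ab[OF that(1)] ab[OF that(2)] V by (intro gallai_colorings_eqI[of \<phi> V \<psi>])
      (auto simp: connected_colorings_def insert_commute)
  moreover have "finite V" using V by simp
  ultimately show ?thesis
    using finite_connected_colorings[of V c] by (simp add: card_le_Suc0_iff_eq)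
qed

text \<open>Each vertex meets an edge of color \<open>c\<close>, so at most one edge has another
  color: 1 + 3 * 2 possibilities.\<close>

lemma card_connected_three:
  assumes "card V = 3"
  shows "card (connected_colorings V c) \<le> 7"
proof -
  obtain x y z where V: "V = {x, y, z}" "x \<noteq> y" "y \<noteq> z" "x \<noteq> z"
    using assms by (auto simp: card_3_iff)
  obtain r g where rg: "r \<noteq> c" "g \<noteq> c" "r \<noteq> g" "UNIV = {c, r, g}"
    using exists_two_other_colors by blast
  let ?T = "{(c, c, c), (c, c, r), (c, c, g), (c, r, c), (c, g, c), (r, c, c), (g, c, c)}"
  define F where "F \<phi> = (\<phi> {x, y}, \<phi> {y, z}, \<phi> {x, z})" for \<phi> :: "'a set \<Rightarrow> color"
  have "inj_on F (connected_colorings V c)"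
  proof (rule inj_onI)
    fix \<phi> \<psi> assume *: "\<phi> \<in> connected_colorings V c" "\<psi> \<in> connected_colorings V c" "F \<phi> = F \<psi>"
    show "\<phi> = \<psi>"
    proof (rule gallai_colorings_eqI)
      show "\<phi> \<in> gallai_colorings V" "\<psi> \<in> gallai_colorings V"
        using * by (auto simp: connected_colorings_def)
      show "\<phi> {u, v} = \<psi> {u, v}" if "u \<in> V" "v \<in> V" "u \<noteq> v" for u v
        using that *(3) V by (auto simp: F_def insert_commute)
    qed
  qed
  moreover have "F ` connected_colorings V c \<subseteq> ?T"
  proof (rule image_subsetI)
    fix \<phi> assume "\<phi> \<in> connected_colorings V c"
    then have conn: "color_connected V \<phi> c" by (simp add: connected_colorings_def)
    have "\<phi> {x, y} = c \<or> \<phi> {x, z} = c"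
      using color_connected_imp_color_at[OF conn, of x y] V by auto
    moreover have "\<phi> {x, y} = c \<or> \<phi> {y, z} = c"
      using color_connected_imp_color_at[OF conn, of y x] V by (auto simp: insert_commute)
    moreover have "\<phi> {x, z} = c \<or> \<phi> {y, z} = c"
      using color_connected_imp_color_at[OF conn, of z x] V by (auto simp: insert_commute)
    moreover have "d = c \<or> d = r \<or> d = g" for d using rg(4) by blast
    ultimately show "F \<phi> \<in> ?T" unfolding F_def by (smt (verit) insert_iff)
  qed
  ultimately have "card (connected_colorings V c) \<le> card ?T"
    by (rule card_inj_on_le) simp
  also have "\<dots> \<le> 7" using rg by simp
  finally show ?thesis .
qed

subsection \<open>The recurrence\<close>

text \<open>The list entries from index 2 on are the values of the right-hand side of \<open>bound_recurrence\<close>.\<close>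

definition disconnected_bound :: "nat \<Rightarrow> nat" where
  "disconnected_bound n =
    (if n < 12 then [0, 0, 2, 14, 174, 6212, 319804, 23927080, 2750159136, 523992222144,
       179901146947072, 120396947689787520] ! n
     else 12 * 2 ^ (n choose 2))"

text \<open>The doubled value would be 0 at \<open>n = 1\<close>, which is too small, and 4 and 28
  at \<open>n = 2\<close> and \<open>n = 3\<close>, where the sharp 1 and 7 are available.\<close>

definition connected_bound :: "nat \<Rightarrow> nat" where
  "connected_bound n =
    (if n = 1 \<or> n = 2 then 1 else if n = 3 then 7 else 2 * disconnected_bound n)"

text \<open>Bounds the sum of \<open>card (attachments W c \<psi>)\<close> over the Gallai colorings
  of an \<open>m\<close>-set \<open>W\<close>. At \<open>m = 1\<close> the general formula would
  give 3 instead of the true 2.\<close>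

definition attachment_bound :: "nat \<Rightarrow> nat" where
  "attachment_bound m =
    (if m = 1 then 2
     else 2 * connected_bound m + 2 ^ (m - 1) * (disconnected_bound m + 2 ^ (m choose 2)))"

text \<open>Pairs inside the two parts, plus the \<open>a * b\<close> pairs between them.\<close>

lemma add_choose_two: "(a + b) choose 2 = (a choose 2) + (b choose 2) + a * (b::nat)"
  by (induction b) (simp_all add: numeral_2_eq_2)

lemma power_choose_two_add:
  "(2::nat) ^ ((a + b) choose 2) = 2 ^ (a choose 2) * 2 ^ (b choose 2) * 2 ^ (a * b)"
  by (simp add: add_choose_two power_add)

lemma less_12_cases:
  "n < 12 \<Longrightarrow> n = 0 \<or> n = 1 \<or> n = 2 \<or> n = 3 \<or> n = 4 \<or> n = 5 \<or> n = 6 \<or> n = 7 \<or> n = 8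
    \<or> n = 9 \<or> n = 10 \<or> n = (11::nat)"
  by presburger

lemma one_choose_two [simp]: "Suc 0 choose 2 = 0"
  by (simp add: choose_two)

text \<open>Among the table entries the ratio to \<open>2 ^ (n choose 2)\<close> is largest at
  \<open>n = 7\<close>, about 11.4; this is why the constant is 12.\<close>

lemma disconnected_bound_le: "disconnected_bound n \<le> 12 * 2 ^ (n choose 2)"
proof (cases "n < 12")
  case True
  from less_12_cases[OF this] show ?thesis
    by (elim disjE) (simp_all add: disconnected_bound_def choose_two)
qed (simp add: disconnected_bound_def)

lemma connected_bound_le: "connected_bound n \<le> 24 * 2 ^ (n choose 2)"
  using disconnected_bound_le[of n] by (auto simp: connected_bound_def choose_two)

text \<open>Here 37 = 24 + 13: the connected part contributes 48 <= 24 * \<open>2 ^ (m - 1)\<close>,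
  the disconnected part 12 + 1.\<close>

lemma attachment_bound_le:
  assumes "m \<ge> 2"
  shows "attachment_bound m \<le> 37 * 2 ^ (m - 1) * 2 ^ (m choose 2)"
proof -
  obtain k where m: "m = k + 2" using assms by (metis add.commute le_Suc_ex)
  have "24 * (2::nat) ^ (m - 1) \<ge> 48" by (simp add: m)
  then have *: "48 * 2 ^ (m choose 2) \<le> 24 * ((2::nat) ^ (m - 1) * 2 ^ (m choose 2))" by simp
  have "attachment_bound m = 2 * connected_bound m + 2 ^ (m - 1) * (disconnected_bound m + 2 ^ (m choose 2))"
    using assms by (simp add: attachment_bound_def)
  also have "\<dots> \<le> 2 * (24 * 2 ^ (m choose 2)) + 2 ^ (m - 1) * (12 * 2 ^ (m choose 2) + 2 ^ (m choose 2))"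
    by (intro add_mono mult_left_mono connected_bound_le disconnected_bound_le) auto
  also have "\<dots> = 48 * 2 ^ (m choose 2) + 13 * (2 ^ (m - 1) * 2 ^ (m choose 2))"
    by (simp add: algebra_simps)
  finally show ?thesis using * by linarith
qed

text \<open>As before, but now 48 <= 64 <= \<open>2 ^ (m - 1)\<close>, so the connected part costs
  only 1 and 14 = 1 + 13.\<close>

lemma attachment_bound_le_large:
  assumes "m \<ge> 7"
  shows "attachment_bound m \<le> 14 * 2 ^ (m - 1) * 2 ^ (m choose 2)"
proof -
  obtain k where m: "m = k + 7" using assms by (metis add.commute le_Suc_ex)
  have "(2::nat) ^ (m - 1) = 64 * 2 ^ k" by (simp add: m power_add)
  then have "(2::nat) ^ (m - 1) \<ge> 48" by (simp add: order_trans[of _ "64 * 1"])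
  then have *: "48 * 2 ^ (m choose 2) \<le> (2::nat) ^ (m - 1) * 2 ^ (m choose 2)" by simp
  have "attachment_bound m = 2 * connected_bound m + 2 ^ (m - 1) * (disconnected_bound m + 2 ^ (m choose 2))"
    using assms by (simp add: attachment_bound_def)
  also have "\<dots> \<le> 2 * (24 * 2 ^ (m choose 2)) + 2 ^ (m - 1) * (12 * 2 ^ (m choose 2) + 2 ^ (m choose 2))"
    by (intro add_mono mult_left_mono connected_bound_le disconnected_bound_le) auto
  also have "\<dots> = 48 * 2 ^ (m choose 2) + 13 * (2 ^ (m - 1) * 2 ^ (m choose 2))"
    by (simp add: algebra_simps)
  finally show ?thesis using * by linarith
qed

text \<open>In units of \<open>2 ^ (n choose 2)\<close>, the terms \<open>j = 1\<close>,
  \<open>j = 2\<close> and \<open>j = n - 1\<close> contribute at most 7, 7/16 and 1, and all others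
  together at most 888/256; the total is below 12.\<close>

lemma bound_recurrence_large:
  assumes "n \<ge> 12"
  shows "(\<Sum>j\<in>{1..<n}. (n - 1 choose (j - 1)) * (connected_bound j * attachment_bound (n - j)))
    \<le> disconnected_bound n"
proof -
  let ?t = "\<lambda>j. (n - 1 choose (j - 1)) * (connected_bound j * attachment_bound (n - j))"
  let ?P = "2 ^ (n choose 2) :: nat"
  obtain k where k: "n = k + 12" using assms by (metis add.commute le_Suc_ex)
  have lin: "k + 1 \<le> 2 ^ k" by (induction k) auto
  have first: "?t 1 \<le> 7 * ?P"
  proof -
    have "?t 1 \<le> 14 * 2 ^ (k + 10) * 2 ^ (k + 11 choose 2)"
      using attachment_bound_le_large[of "k + 11"] by (simp add: k connected_bound_def add.commute)
    also have "\<dots> = 7 * ?P"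
      using power_choose_two_add[of 1 "k + 11"] by (simp add: k power_add add.commute)
    finally show ?thesis .
  qed
  have second: "16 * ?t 2 \<le> 7 * ?P"
  proof -
    have "16 * ?t 2 = 16 * ((k + 11) * attachment_bound (k + 10))"
      by (simp add: k connected_bound_def add.commute)
    \<comment> \<open>The crude estimate \<open>k + 11 <= 128 * 2 ^ k\<close> is chosen so that the
      product becomes exactly \<open>7 * 2 ^ (n choose 2)\<close>.\<close>
    also have "\<dots> \<le> 16 * ((128 * 2 ^ k) * (14 * 2 ^ (k + 9) * 2 ^ (k + 10 choose 2)))"
      using attachment_bound_le_large[of "k + 10"] lin
      by (intro mult_mono) (auto simp: add.commute)
    also have "\<dots> = 7 * ?P"
      using power_choose_two_add[of 2 "k + 10"]
      by (simp add: k power_add power_mult_distrib algebra_simps power_mult power2_eq_square)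
    finally show ?thesis .
  qed
  have last: "?t (n - 1) \<le> ?P"
  proof -
    have "?t (n - 1) = (k + 11) * (connected_bound (k + 11) * 2)"
    proof -
      have "(k + 11 choose (k + 10)) = k + 11"
        using binomial_symmetric[of 1 "k + 11"] by (simp add: add.commute)
      then show ?thesis by (simp add: k attachment_bound_def add.commute)
    qed
    also have "\<dots> \<le> (k + 11) * ((24 * 2 ^ (k + 11 choose 2)) * 2)"
      by (intro mult_left_mono mult_right_mono connected_bound_le) auto
    also have "\<dots> = (48 * (k + 11)) * 2 ^ (k + 11 choose 2)" by simp
    also have "\<dots> \<le> (2048 * 2 ^ k) * 2 ^ (k + 11 choose 2)"
      using lin by (intro mult_right_mono) auto
    also have "\<dots> = ?P"
      using power_choose_two_add[of 1 "k + 11"] by (simp add: k power_add add.commute)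
    finally show ?thesis .
  qed
  have middle: "256 * (\<Sum>j\<in>{3..<n - 1}. ?t j) \<le> 888 * ?P"
  proof -
    \<comment> \<open>The constant is 888 = 24 * 37. The \<open>j * (n - j)\<close> edges between
      the parts outweigh the factor \<open>2 ^ (n - j - 1)\<close> by at least
      \<open>2 ^ (2 * k + 19)\<close>, whatever \<open>j\<close> is.\<close>
    have "?t j * 2 ^ (2 * k + 19) \<le> (n - 1 choose (j - 1)) * (888 * ?P)" if j: "j \<in> {3..<n - 1}" for j
    proof -
      obtain a where a: "j = a + 3" using j by (metis add.commute atLeastLessThan_iff le_Suc_ex)
      obtain b where b: "n = j + (b + 2)"
      proof
        show "n = j + ((n - j - 2) + 2)" using j by auto
      qed
      have "connected_bound j * attachment_bound (n - j) * 2 ^ (2 * k + 19)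
          \<le> (24 * 2 ^ (j choose 2)) * (37 * 2 ^ (b + 1) * 2 ^ (b + 2 choose 2)) * 2 ^ (2 * k + 19)"
        using connected_bound_le[of j] attachment_bound_le[of "b + 2"]
        by (intro mult_right_mono mult_mono) (auto simp: b)
      also have "\<dots> = 888 * (2 ^ (j choose 2) * 2 ^ (b + 2 choose 2) * 2 ^ ((b + 1) + (2 * k + 19)))"
        by (simp add: power_add)
      also have "\<dots> \<le> 888 * (2 ^ (j choose 2) * 2 ^ (b + 2 choose 2) * 2 ^ (j * (b + 2)))"
      proof -
        have "k + 12 = a + b + 5" using k b a by simp
        \<comment> \<open>The difference of the two sides is \<open>a * b\<close>.\<close>
        then have "(b + 1) + (2 * k + 19) \<le> j * (b + 2)" by (simp add: a algebra_simps)
        then show ?thesis by (intro mult_left_mono power_increasing) auto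
      qed
      also have "\<dots> = 888 * ?P" by (simp only: b power_choose_two_add)
      finally show ?thesis by (simp add: mult.assoc)
    qed
    then have "(\<Sum>j\<in>{3..<n - 1}. ?t j * 2 ^ (2 * k + 19))
        \<le> (\<Sum>j\<in>{3..<n - 1}. (n - 1 choose (j - 1)) * (888 * ?P))"
      by (rule sum_mono)
    then have "(\<Sum>j\<in>{3..<n - 1}. ?t j) * 2 ^ (2 * k + 19)
        \<le> (\<Sum>j\<in>{3..<n - 1}. n - 1 choose (j - 1)) * (888 * ?P)"
      by (simp only: sum_distrib_right)
    also have "\<dots> \<le> 2 ^ (n - 1) * (888 * ?P)"
    proof -
      have "(\<Sum>j\<in>{3..<n - 1}. n - 1 choose (j - 1)) = (\<Sum>i\<in>(\<lambda>j. j - 1) ` {3..<n - 1}. n - 1 choose i)"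
        by (subst sum.reindex) (auto simp: inj_on_def)
      also have "\<dots> \<le> (\<Sum>i\<le>n - 1. n - 1 choose i)" by (rule sum_mono2) auto
      also have "\<dots> = 2 ^ (n - 1)" by (rule choose_row_sum)
      finally show ?thesis by (rule mult_right_mono) simp
    qed
    finally have le: "(\<Sum>j\<in>{3..<n - 1}. ?t j) * 2 ^ (2 * k + 19) \<le> 2 ^ (n - 1) * (888 * ?P)" .
    define X where "X = (\<Sum>j\<in>{3..<n - 1}. ?t j)"
    \<comment> \<open>The sum of the binomial coefficients uses up \<open>2 ^ (n - 1)\<close> of the
      saving; \<open>256 * 2 ^ k\<close> is left, of which 256 suffices.\<close>
    have "2 * k + 19 = (n - 1) + (8 + k)" by (simp add: k)
    then have "(2::nat) ^ (2 * k + 19) = 2 ^ (n - 1) * (256 * 2 ^ k)"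
      by (simp only: power_add) simp
    then have "X * 2 ^ (2 * k + 19) = 2 ^ (n - 1) * ((256 * 2 ^ k) * X)"
      by simp
    then have "2 ^ (n - 1) * ((256 * 2 ^ k) * X) \<le> 2 ^ (n - 1) * (888 * ?P)"
      using le unfolding X_def by (simp only:)
    then have "(256 * 2 ^ k) * X \<le> 888 * ?P"
      by (simp only: mult_le_cancel1) simp
    moreover have "256 * X \<le> (256 * 2 ^ k) * X"
      by (intro mult_right_mono) auto
    ultimately show ?thesis unfolding X_def by linarith
  qed
  have "{1..<n} = {1, 2} \<union> {3..<n - 1} \<union> {n - 1}" using assms by auto
  then have "(\<Sum>j\<in>{1..<n}. ?t j) = (\<Sum>j\<in>{1, 2} \<union> {3..<n - 1} \<union> {n - 1}. ?t j)" by (rule arg_cong)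
  also have "\<dots> = ?t 1 + ?t 2 + (\<Sum>j\<in>{3..<n - 1}. ?t j) + ?t (n - 1)"
    using assms by (subst sum.union_disjoint; (subst sum.union_disjoint)?) auto
  also have "\<dots> \<le> 12 * ?P" using first second middle last by linarith
  finally show ?thesis using assms by (simp add: disconnected_bound_def)
qed

text \<open>Pascal's rule for numerals; with the next lemma it lets the simplifier evaluate the
  recurrence for concrete \<open>n\<close>.\<close>

lemma numeral_choose_numeral:
  "numeral n choose numeral k = (pred_numeral n choose pred_numeral k) + (pred_numeral n choose numeral k)"
  by (simp add: numeral_eq_Suc)

lemma sum_atLeastLessThan_numeral:
  "sum f {Suc 0..<numeral k} =
    (if Suc 0 \<le> pred_numeral k then sum f {Suc 0..<pred_numeral k} + f (pred_numeral k) else 0)"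
  by (simp add: numeral_eq_Suc)

lemma bound_recurrence_small:
  assumes "2 \<le> n" "n < 12"
  shows "(\<Sum>j\<in>{1..<n}. (n - 1 choose (j - 1)) * (connected_bound j * attachment_bound (n - j)))
    \<le> disconnected_bound n"
  using less_12_cases[OF assms(2)] assms(1)
  by (elim disjE) (simp_all add: sum_atLeastLessThan_numeral numeral_choose_numeral
      attachment_bound_def connected_bound_def disconnected_bound_def choose_two)

lemma bound_recurrence:
  assumes "2 \<le> n"
  shows "(\<Sum>j\<in>{1..<n}. (n - 1 choose (j - 1)) * (connected_bound j * attachment_bound (n - j)))
    \<le> disconnected_bound n"
  using bound_recurrence_small bound_recurrence_large assms by (cases "n < 12") auto

subsection \<open>The number of colorings\<close>

lemma sum_attachments_le_bound:
  assumes "finite W" "W \<noteq> {}" "card (connected_colorings W c) \<le> connected_bound (card W)"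
    and "card (disconnected_colorings W c) \<le> disconnected_bound (card W)"
  shows "(\<Sum>\<psi>\<in>gallai_colorings W. card (attachments W c \<psi>)) \<le> attachment_bound (card W)"
proof (cases "card W = 1")
  case True
  then obtain a where W: "W = {a}" by (auto simp: card_1_singleton_iff)
  have "disconnected_colorings W c = {}" unfolding W by (rule disconnected_singleton)
  then show ?thesis
    using sum_attachments_split[OF assms(1), of c] sum_attachments_connected[OF assms(1,2), of c]
      card_connected_singleton[of a c] True
    by (simp add: attachment_bound_def W)
next
  case False
  have "(\<Sum>\<psi>\<in>gallai_colorings W. card (attachments W c \<psi>)) \<le> 2 * card (connected_colorings W c) +
      2 ^ (card W - 1) * (card (disconnected_colorings W c) + 2 ^ (card W choose 2))"
    unfolding sum_attachments_split[OF assms(1), of c]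
    by (intro add_mono sum_attachments_connected sum_attachments_disconnected assms)
  also have "\<dots> \<le> 2 * connected_bound (card W) +
      2 ^ (card W - 1) * (disconnected_bound (card W) + 2 ^ (card W choose 2))"
    by (intro add_mono mult_left_mono assms) auto
  finally show ?thesis using False by (simp add: attachment_bound_def)
qed

text \<open>Strong induction on the vertex set. The disconnected bound comes from the smaller sets
  \<open>C\<close> and \<open>V - C\<close> through the recurrence; the connected bound then follows
  from the disconnected one on \<open>V\<close> itself.\<close>

lemma card_colorings_le_bound:
  assumes "finite V" "V \<noteq> {}"
  shows "card (disconnected_colorings V c) \<le> disconnected_bound (card V) \<and>
    card (connected_colorings V c) \<le> connected_bound (card V)"
  using assms
proof (induction V arbitrary: c rule: finite_psubset_induct)
  case (psubset V)
  show ?case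
  proof (cases "card V = 1")
    case True
    then obtain a where "V = {a}" by (auto simp: card_1_singleton_iff)
    then show ?thesis
      using card_connected_singleton[of a c] by (simp add: disconnected_singleton connected_bound_def)
  next
    case False
    moreover have "card V \<noteq> 0" using psubset.hyps psubset.prems by simp
    ultimately have V2: "card V \<ge> 2" by linarith
    obtain v where v: "v \<in> V" using psubset.prems by blast
    \<comment> \<open>Needed for every color, since the connected bound for \<open>c\<close> rests
      on the disconnected bounds for the other two.\<close>
    have disc: "card (disconnected_colorings V c) \<le> disconnected_bound (card V)" for c
    proof -
      have "card (disconnected_colorings V c) \<le>
        (\<Sum>C\<in>{C. v \<in> C \<and> C \<subset> V}. card (connected_colorings C c) *
          (\<Sum>\<psi>\<in>gallai_colorings (V - C). card (attachments (V - C) c \<psi>)))"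
        by (rule card_disconnected_le_sum[OF psubset.hyps v])
      also have "\<dots> \<le> (\<Sum>C\<in>{C. v \<in> C \<and> C \<subset> V}.
          connected_bound (card C) * attachment_bound (card V - card C))"
      proof (rule sum_mono)
        fix C assume "C \<in> {C. v \<in> C \<and> C \<subset> V}"
        then have C: "v \<in> C" "C \<subset> V" by auto
        then have W: "V - C \<subset> V" "V - C \<noteq> {}" "finite (V - C)"
          using psubset.hyps by auto
        have "card (V - C) = card V - card C"
          using C psubset.hyps by (meson card_Diff_subset finite_subset psubset_imp_subset)
        moreover have "(\<Sum>\<psi>\<in>gallai_colorings (V - C). card (attachments (V - C) c \<psi>))
            \<le> attachment_bound (card (V - C))"
          using psubset.IH[OF W(1,2), of c] by (intro sum_attachments_le_bound W) auto
        moreover have "card (connected_colorings C c) \<le> connected_bound (card C)"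
          using psubset.IH[OF C(2), of c] C(1) by blast
        ultimately show "card (connected_colorings C c) *
            (\<Sum>\<psi>\<in>gallai_colorings (V - C). card (attachments (V - C) c \<psi>))
            \<le> connected_bound (card C) * attachment_bound (card V - card C)"
          by (simp add: mult_mono)
      qed
      also have "\<dots> = (\<Sum>j\<in>{1..<card V}. (card V - 1 choose (j - 1)) *
          (connected_bound j * attachment_bound (card V - j)))"
        by (rule sum_proper_subsets_containing[OF psubset.hyps v])
      also have "\<dots> \<le> disconnected_bound (card V)" by (rule bound_recurrence[OF V2])
      finally show ?thesis .
    qed
    moreover have "card (connected_colorings V c) \<le> connected_bound (card V)"
      using card_connected_le_disconnected[OF psubset.hyps V2 disc, of c]
        card_connected_two[of V c] card_connected_three[of V c] False
      by (auto simp: connected_bound_def)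
    ultimately show ?thesis by blast
  qed
qed

lemma rainbow_free_colorings_eq: "rainbow_free_colorings n = gallai_colorings {..<n}"
  unfolding rainbow_free_colorings_def edge_colorings_def K_edges_def gallai_colorings_def
    gallai_on_def rainbow_triangle_def
  by (rule Collect_cong) (auto simp only: lessThan_iff Ball_def)

theorem theorem1p1:
  fixes n :: nat
  assumes "n \<ge> 2"
  shows "num_rainbow_free n \<le> 7 * (n + 1) * 2 ^ (n choose 2)"
proof -
  have "card (disconnected_colorings {..<n} Red) \<le> disconnected_bound n"
    "card (connected_colorings {..<n} Red) \<le> connected_bound n"
    using card_colorings_le_bound[of "{..<n}" Red] assms by (auto simp: lessThan_empty_iff)
  then have le: "num_rainbow_free n \<le> connected_bound n + disconnected_bound n"
    using card_gallai_colorings_eq[of "{..<n}" Red]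
    by (simp add: num_rainbow_free_def rainbow_free_colorings_eq)
  \<comment> \<open>The general estimate has the factor 36 = 3 * 12, and 36 <= 7 * (n + 1) starts at
    \<open>n = 5\<close>; at \<open>n = 4\<close> the right side is only 35, so smaller
    \<open>n\<close> are evaluated directly.\<close>
  consider "n = 2" | "n = 3" | "n = 4" | "n \<ge> 5" using assms by linarith
  then show ?thesis
  proof cases
    case 4
    then have "connected_bound n + disconnected_bound n = 3 * disconnected_bound n"
      by (simp add: connected_bound_def)
    also have "\<dots> \<le> 36 * 2 ^ (n choose 2)" using disconnected_bound_le[of n] by simp
    also have "\<dots> \<le> 7 * (n + 1) * 2 ^ (n choose 2)" using 4 by (intro mult_right_mono) auto
    finally show ?thesis using le by linarith
  qed (use le in \<open>simp_all add: connected_bound_def disconnected_bound_def choose_two\<close>)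
qed

end
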